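(* Let the plant data $(A_{11},\hat A_{12},\dots,D_2)$, the value set $\mathbf V$ and $\gamma>0$ be given as in the context. Suppose there exist a structured controller (i.e. $n^c$, $r^c=r^c_1+r^c_2$, structured controller matrices $A^c_{ij},B^c_i,C^c_j,D^c$ and a lower block-triangular scheduling function $\Delta_c:\mathbf V\to\mathbb R^{r^c\times r^c}$, as in the context) as well as symmetric matrices $\mathcal X_1\succ0$, $Z\succ0$ with $\operatorname{tr}(Z)<1$, and $\mathcal P\in\mathbf P$ such that the closed-loop matrices $\mathcal A_{ij},\mathcal B_i,\mathcal C_j,\mathcal D$ of the lifted plant with this controller satisfy $$ \mathcal L_{\rm sub}\!\left(\begin{pmatrix}-\mathcal X_1&0\\ 0&0\end{pmatrix},\begin{pmatrix}0&\mathcal P\\ \mathcal P&0\end{pmatrix},P_Z,\begin{pmatrix}\mathcal A_{ij}\\ \mathcal C_j\end{pmatrix}\right)\prec0,\qquad \mathcal L\!\left(\begin{pmatrix}0&\mathcal X_1\\ \mathcal X_1&0\end{pmatrix},\begin{pmatrix}0&\mathcal P\\ \mathcal P&0\end{pmatrix},P_\gamma,\begin{pmatrix}\mathcal A_{ij}&\mathcal B_i\\ \mathcal C_j&\mathcal D\end{pmatrix}\right)\prec0 . $$ Then there exists (one can construct) a symmetric matrix $\hat{\mathcal P}\in\mathbb S^{\hat u+r^c+\hat v+r^c}$ with $$ \begin{pmatrix}\Delta_{ex}(V)\\ I_{\hat v+r^c}\end{pmatrix}^{T}\hat{\mathcal P}\begin{pmatrix}\Delta_{ex}(V)\\ I_{\hat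 v+r^c}\end{pmatrix}\succ0\quad\text{for all }V\in\mathbf V,\qquad \Delta_{ex}(V):=\begin{pmatrix}V&0\\ 0&\Delta_c(V)\end{pmatrix}, $$ such that, for the closed-loop matrices $\hat{\mathcal A}_{ij},\hat{\mathcal B}_i,\hat{\mathcal C}_j,\hat{\mathcal D}$ of the original plant with the same controller (and with the same $\mathcal X_1$, $Z$, $\gamma$), $$ \mathcal L_{\rm sub}\!\left(\begin{pmatrix}-\mathcal X_1&0\\ 0&0\end{pmatrix},\hat{\mathcal P},P_Z,\begin{pmatrix}\hat{\mathcal A}_{ij}\\ \hat{\mathcal C}_j\end{pmatrix}\right)\prec0,\qquad \mathcal L\!\left(\begin{pmatrix}0&\mathcal X_1\\ \mathcal X_1&0\end{pmatrix},\hat{\mathcal P},P_\gamma,\begin{pmatrix}\hat{\mathcal A}_{ij}&\hat{\mathcal B}_i\\ \hat{\mathcal C}_j&\hat{\mathcal D}\end{pmatrix}\right)\prec0 . $$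
   Context: All matrices are real. $\mathbb S^n$ is the set of symmetric $n\times n$ matrices, $\operatorname{He}(M):=M+M^T$, and $\prec,\succ$ denote negative/positive definiteness of symmetric matrices. For matrices of compatible sizes ($i,j=1,2$), $$ \mathcal L\!\left(X,R,S,\begin{pmatrix}A_{ij}&B_i\\ C_j&D\end{pmatrix}\right):=F^T\begin{pmatrix}X&0&0\\ 0&R&0\\ 0&0&S\end{pmatrix}F,\qquad F:=\begin{pmatrix}I&0&0\\ A_{11}&A_{12}&B_1\\ 0&I&0\\ A_{21}&A_{22}&B_2\\ 0&0&I\\ C_1&C_2&D\end{pmatrix}, $$ where $X$, $R$, $S$ act on the first, second and third pair of block rows of $F$, respectively, and $\mathcal L_{\rm sub}(X,R,S,\begin{pmatrix}A_{ij}\\ C_j\end{pmatrix})$ is the same expression with the third block column of $F$ removed (i.e. the left upper $2\times2$ sub-block of $\mathcal L$). **Original plant.** Signals: state $x\in\mathbb R^{n^s}$, uncertainty channel $\hat w=\operatorname{col}(\hat w_1,\hat w_2)\in\mathbb R^{\hat u}$, $\hat z=\operatorname{col}(\hat z_1,\hat z_2)\in\mathbb R^{\hat v}$, performance channel $w_p,z_p$, control input $u\in\mathbb R^m$, measurement $y\in\mathbb R^k$: $$ \begin{pmatrix}\dot x\\ \hat z\\ z_p\\ y\end{pmatrix}=\begin{pmatrix}A_{11}&\hat A_{12}&B_1^p&B_1\\ \hat A_{21}&\hat A_{22}&\hat B_2^p&\hat B_2\\ C_1^p&\hat C_2^p&D^p&D_1\\ C_1&\hat C_2&D_2&0\end{pmatrix}\begin{pmatrix}x\\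 \hat w\\ w_p\\ u\end{pmatrix},\qquad \hat w=\Delta\hat z, $$ where $D^p=0$ and, with respect to the partitions of $\hat w,\hat z$, $$\hat A_{22}=\begin{pmatrix}\bar A_{22}&0\\ \bar A_{32}&\bar A_{33}\end{pmatrix},\quad \hat B_2^p=\begin{pmatrix}0\\ \bar B_3^p\end{pmatrix},\quad \hat C_2^p=\begin{pmatrix}\bar C_2^p&0\end{pmatrix},$$ the remaining blocks being unstructured. Here $\Delta$ is a continuous function on $[0,\infty)$ with values in $\mathbf V=\mathrm{Co}\{\Delta_1,\dots,\Delta_N\}\ni0$, the convex hull of finitely many matrices $\Delta_l\in\mathbb R^{\hat u\times\hat v}$; the elements of $\mathbf V$ are block-diagonal of the form $\operatorname{diag}(\hat V,\hat V)$, compatibly with the partition of $\hat A_{22}$. **Lifted plant.** With $r^s:=\hat u+\hat v$, put $\Delta_l(V):=\begin{pmatrix}-I_{\hat u}&2V\\ 0&I_{\hat v}\end{pmatrix}$ for $V\in\mathbf V$. The lifted plant has the same $A_{11},B_1^p,B_1,C_1^p,D^p,D_1,C_1,D_2$ and uncertainty channel $w\to z$ of size $r^s\times r^s$, $w=\Delta_l(\Delta)z$, with $$A_{12}=\begin{pmatrix}\hat A_{12}&0\end{pmatrix},\ A_{21}=\begin{pmatrix}0\\ 2\hat A_{21}\end{pmatrix},\ A_{22}=\begin{pmatrix}I_{\hat u}&0\\ 2\hat A_{22}&-I_{\hat v}\end{pmatrix},\ B_2^p=\begin{pmatrix}0\\ 2\hat B_2^p\end{pmatrix},\ B_2=\begin{pmatrix}0\\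 2\hat B_2\end{pmatrix},$$ $$C_2^p=\begin{pmatrix}\hat C_2^p&0\end{pmatrix},\ C_2=\begin{pmatrix}\hat C_2&0\end{pmatrix}.$$ **Structured controller.** Given by dimensions $n^c$ and $r^c=r^c_1+r^c_2$, a function $\Delta_c:\mathbf V\to\mathbb R^{r^c\times r^c}$ of the lower block-triangular form $\Delta_c(V)=\begin{pmatrix}\Delta^c_{11}(V)&0\\ \Delta^c_{21}(V)&\Delta^c_{22}(V)\end{pmatrix}$ (partition $r^c_1+r^c_2$; possibly nonlinear in $V$), and $$ \begin{pmatrix}\dot x_c\\ \hat z_c\\ u\end{pmatrix}=\begin{pmatrix}A^c_{11}&A^c_{12}&B^c_1\\ A^c_{21}&A^c_{22}&B^c_2\\ C^c_1&C^c_2&D^c\end{pmatrix}\begin{pmatrix}x_c\\ \hat w_c\\ y\end{pmatrix},\quad \hat w_c=\Delta_c(\Delta)\hat z_c, $$ with $A^c_{11}\in\mathbb R^{n^c\times n^c}$, $A^c_{22}\in\mathbb R^{r^c\times r^c}$, and with respect to $r^c=r^c_1+r^c_2$, $$A^c_{22}=\begin{pmatrix}\bar A^c_{22}&0\\ \bar A^c_{32}&\bar A^c_{33}\end{pmatrix},\quad B^c_2=\begin{pmatrix}0\\ \bar B^c_3\end{pmatrix},\quad C^c_2=\begin{pmatrix}\bar C^c_2&0\end{pmatrix},\quad D^c=0.$$ **Closed-loop matrices.** For the lifted plant, for $i,j=1,2$, $$ \begin{pmatrix}\mathcal A_{ij}&\mathcal B_i\\ \mathcal C_j&\mathcal D\end{pmatrix}=\begin{pmatrix}A_{ij}&0&B_i^p\\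 0&0&0\\ C_j^p&0&D^p\end{pmatrix}+\begin{pmatrix}0&B_i\\ I&0\\ 0&D_1\end{pmatrix}\begin{pmatrix}A^c_{ij}&B^c_i\\ C^c_j&D^c\end{pmatrix}\begin{pmatrix}0&I&0\\ C_j&0&D_2\end{pmatrix}. $$ For the original plant, $\hat{\mathcal A}_{ij},\hat{\mathcal B}_i,\hat{\mathcal C}_j,\hat{\mathcal D}$ are given by the same formula with $A_{12},A_{21},A_{22},B_2^p,B_2,C_2^p,C_2$ replaced by $\hat A_{12},\hat A_{21},\hat A_{22},\hat B_2^p,\hat B_2,\hat C_2^p,\hat C_2$ (and $A_{11},B_1^p,B_1,C_1^p,C_1,D^p,D_1,D_2$ unchanged). **Scalings.** With $\Delta_{lc}(V):=\begin{pmatrix}\Delta_l(V)&0\\ 0&\Delta_c(V)\end{pmatrix}$ and $r:=r^s+r^c$, $$\mathbf P:=\{\mathcal P\in\mathbb S^{r}\mid \operatorname{He}[\mathcal P\Delta_{lc}(V)]\succ0\text{ for all }V\in\mathbf V\}.$$ Moreover $P_Z:=\begin{pmatrix}0&0\\ 0&Z^{-1}\end{pmatrix}$ and $P_\gamma:=\begin{pmatrix}-\gamma I&0\\ 0&0\end{pmatrix}$, partitioned according to the dimensions of $(w_p,z_p)$. *)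

theory Defs
  imports "Jordan_Normal_Form.Gauss_Jordan_Elimination"
begin

section \<open>Matrices\<close>

text \<open>
  The matrix literal \<open>block_mat [[A, B], [C, D]]\<close> denotes the block matrix written in that way. Block
  sizes are read off the blocks, so zero and identity blocks carry their sizes explicitly; blocks
  with no rows or no columns are allowed.
\<close>

definition append_cols :: "real mat \<Rightarrow> real mat \<Rightarrow> real mat" where
  "append_cols A B = four_block_mat A B (0\<^sub>m 0 (dim_col A)) (0\<^sub>m 0 (dim_col B))"

definition block_row :: "real mat list \<Rightarrow> real mat" where
  "block_row As = foldr append_cols As (0\<^sub>m 0 0)"

definition block_mat :: "real mat list list \<Rightarrow> real mat" where
  "block_mat Ass = foldr append_rows (map block_row Ass) (0\<^sub>m 0 0)"

definition sym_mats :: "nat \<Rightarrow> real mat set" where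
  "sym_mats n = {M \<in> carrier_mat n n. M\<^sup>T = M}"

definition pos_def :: "real mat \<Rightarrow> bool" where
  "pos_def M \<longleftrightarrow> M \<in> sym_mats (dim_row M) \<and>
     (\<forall>x \<in> carrier_vec (dim_row M). x \<noteq> 0\<^sub>v (dim_row M) \<longrightarrow> x \<bullet> (M *\<^sub>v x) > 0)"

definition neg_def :: "real mat \<Rightarrow> bool" where
  "neg_def M \<longleftrightarrow> M \<in> sym_mats (dim_row M) \<and>
     (\<forall>x \<in> carrier_vec (dim_row M). x \<noteq> 0\<^sub>v (dim_row M) \<longrightarrow> x \<bullet> (M *\<^sub>v x) < 0)"

definition He :: "real mat \<Rightarrow> real mat" where
  "He M = M + M\<^sup>T"

definition mat_trace :: "real mat \<Rightarrow> real" where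
  "mat_trace M = sum_list (diag_mat M)"

text \<open>Convex hull of the \<open>nr \<times> nc\<close> matrices \<open>\<Delta> 0, \<dots>, \<Delta> (N - 1)\<close>.\<close>

definition mat_hull :: "nat \<Rightarrow> nat \<Rightarrow> nat \<Rightarrow> (nat \<Rightarrow> real mat) \<Rightarrow> real mat set" where
  "mat_hull nr nc N \<Delta> =
     {mat nr nc (\<lambda>ij. \<Sum>l<N. c l * \<Delta> l $$ ij) | c. (\<forall>l<N. c l \<ge> 0) \<and> (\<Sum>l<N. c l) = 1}"

lemma append_cols_dims: "dim_row (append_cols A B) = dim_row A" "dim_col (append_cols A B) = dim_col A + dim_col B"
  by (auto simp: append_cols_def)

lemma append_rows_dims: "dim_row (A @\<^sub>r B) = dim_row A + dim_row B" "dim_col (A @\<^sub>r B) = dim_col A"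
  for A :: "real mat"
  by (auto simp: append_rows_def)

lemma append_cols_index:
  "i < dim_row A \<Longrightarrow> j < dim_col A + dim_col B \<Longrightarrow>
    append_cols A B $$ (i, j) = (if j < dim_col A then A $$ (i, j) else B $$ (i, j - dim_col A))"
  by (simp add: append_cols_def)

lemma append_rows_index:
  "i < dim_row A + dim_row B \<Longrightarrow> j < dim_col A \<Longrightarrow>
    (A @\<^sub>r B) $$ (i, j) = (if i < dim_row A then A $$ (i, j) else B $$ (i - dim_row A, j))"
  for A :: "real mat"
  by (simp add: append_rows_def)

lemma append_empty: "append_cols A (0\<^sub>m 0 0) = A" "A @\<^sub>r 0\<^sub>m 0 0 = A" for A :: "real mat"
  by (rule eq_matI; simp add: append_cols_dims append_rows_dims append_cols_index append_rows_index)+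

lemma mult_append_cols: "dim_row A = dim_row B \<Longrightarrow> M * append_cols A B = append_cols (M * A) (M * B)"
  by (rule eq_matI)
    (auto simp: append_cols_dims append_cols_index scalar_prod_def)

lemma append_rows_mult: "dim_col A = dim_row M \<Longrightarrow> dim_col B = dim_row M \<Longrightarrow> (A @\<^sub>r B) * M = (A * M) @\<^sub>r (B * M)"
  for A B M :: "real mat"
  by (rule eq_matI)
    (auto simp: append_rows_dims append_rows_index scalar_prod_def row_def intro!: sum.cong)

lemma append_cols_mult_rows:
  assumes "dim_col A = dim_row C" "dim_col B = dim_row D" "dim_row A = dim_row B" "dim_col C = dim_col D"
  shows "append_cols A B * (C @\<^sub>r D) = A * C + B * D"
proof (rule eq_matI)
  fix i j assume "i < dim_row (A * C + B * D)" "j < dim_col (A * C + B * D)"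
  then have i: "i < dim_row A" "i < dim_row B" and j: "j < dim_col C" "j < dim_col D" using assms by auto
  let ?f = "\<lambda>k. append_cols A B $$ (i, k) * (C @\<^sub>r D) $$ (k, j)"
  have "(append_cols A B * (C @\<^sub>r D)) $$ (i, j) = sum ?f {0..<dim_row C + dim_row D}"
    using i j assms by (simp add: append_cols_dims append_rows_dims scalar_prod_def)
  also have "\<dots> = sum ?f {0..<dim_row C} + sum ?f {0 + dim_row C..<dim_row D + dim_row C}"
    by (simp add: sum.atLeastLessThan_concat add.commute)
  also have "sum ?f {0 + dim_row C..<dim_row D + dim_row C} = (\<Sum>k = 0..<dim_row D. ?f (k + dim_row C))"
    by (rule sum.shift_bounds_nat_ivl)
  also have "sum ?f {0..<dim_row C} + \<dots> = (A * C + B * D) $$ (i, j)"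
    using i j assms by (simp add: append_cols_index append_rows_index scalar_prod_def)
  finally show "(append_cols A B * (C @\<^sub>r D)) $$ (i, j) = (A * C + B * D) $$ (i, j)" .
qed (use assms in \<open>simp_all add: append_cols_dims append_rows_dims\<close>)

lemma append_cols_add:
  assumes "dim_row A = dim_row C" "dim_col A = dim_col C" "dim_row B = dim_row D" "dim_col B = dim_col D"
    "dim_row A = dim_row B"
  shows "append_cols A B + append_cols C D = append_cols (A + C) (B + D)"
  using assms by (intro eq_matI) (auto simp: append_cols_dims append_cols_index)

lemma append_rows_add:
  fixes A B C D :: "real mat"
  assumes "dim_row A = dim_row C" "dim_col A = dim_col C" "dim_row B = dim_row D" "dim_col B = dim_col D"
    "dim_col A = dim_col B"
  shows "(A @\<^sub>r B) + (C @\<^sub>r D) = (A + C) @\<^sub>r (B + D)"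
  using assms by (intro eq_matI) (auto simp: append_rows_dims append_rows_index)

lemma zero_one_mat_simps: "dim_row A = n \<Longrightarrow> 0\<^sub>m m n * A = 0\<^sub>m m (dim_col A)"
  "dim_col A = n \<Longrightarrow> A * 0\<^sub>m n m = 0\<^sub>m (dim_row A) m"
  "dim_row A = n \<Longrightarrow> 1\<^sub>m n * A = A"
  "dim_col A = n \<Longrightarrow> A * 1\<^sub>m n = A"
  "dim_row A = m \<Longrightarrow> dim_col A = n \<Longrightarrow> 0\<^sub>m m n + A = A"
  "dim_row A = m \<Longrightarrow> dim_col A = n \<Longrightarrow> A + 0\<^sub>m m n = A" for A :: "real mat"
  by auto

lemmas append_simps = append_cols_dims append_rows_dims append_empty mult_append_cols append_rows_mult
  append_cols_mult_rows append_cols_add append_rows_add zero_one_mat_simps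

lemma split_block_append:
  assumes "dim_row A = dim_row B" "dim_row C = dim_row D" "dim_col A = dim_col C" "dim_col B = dim_col D"
  shows "split_block (append_cols A B @\<^sub>r append_cols C D) (dim_row A) (dim_col A) = (A, B, C, D)"
  using assms unfolding split_block_def Let_def
  by (auto intro!: eq_matI simp: append_cols_dims append_rows_dims append_cols_index append_rows_index)

lemma append_cols_assoc:
  "dim_row A = dim_row B \<Longrightarrow> append_cols (append_cols A B) C = append_cols A (append_cols B C)"
  by (rule eq_matI) (auto simp: append_cols_dims append_cols_index)

lemma append_rows_assoc: "dim_col A = dim_col B \<Longrightarrow> (A @\<^sub>r B) @\<^sub>r C = A @\<^sub>r (B @\<^sub>r C)"
  for A B C :: "real mat"
  by (rule eq_matI) (auto simp: append_rows_dims append_rows_index)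

lemma append_swap: "dim_row A = dim_row B \<Longrightarrow> dim_row C = dim_row D \<Longrightarrow> dim_col A = dim_col C \<Longrightarrow> dim_col B = dim_col D \<Longrightarrow>
 append_cols A B @\<^sub>r append_cols C D = append_cols (A @\<^sub>r C) (B @\<^sub>r D)"
  by (rule eq_matI) (auto simp: append_rows_dims append_rows_index append_cols_dims append_cols_index)


section \<open>Plants\<close>

text \<open>
  The indices \<open>i, j = 1, 2\<close> of the blocks \<open>A\<^sub>i\<^sub>j\<close>, \<open>B\<^sub>i\<close>, \<open>C\<^sub>j\<close> are rendered by \<open>St\<close> (state) for
  1 and \<open>Ch\<close> (uncertainty or scheduling channel) for 2.
\<close>

datatype ix = St | Ch

text \<open>
  The same record serves for the original and for the lifted plant:
  \<open>n_w\<close> and \<open>n_z\<close> are the sizes of the input and output of the uncertainty channel.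
  The fields \<open>plBp\<close>, \<open>plCp\<close> are \<open>B\<^sub>i\<^sup>p\<close>, \<open>C\<^sub>j\<^sup>p\<close>; there is no feedthrough from the control input to
  the measurement.
\<close>

record plant =
  n_st :: nat
  n_w :: nat
  n_z :: nat
  n_wp :: nat
  n_zp :: nat
  n_u :: nat
  n_y :: nat
  plA :: "ix \<Rightarrow> ix \<Rightarrow> real mat"
  plBp :: "ix \<Rightarrow> real mat"
  plB :: "ix \<Rightarrow> real mat"
  plCp :: "ix \<Rightarrow> real mat"
  plC :: "ix \<Rightarrow> real mat"
  plDp :: "real mat"
  plD1 :: "real mat"
  plD2 :: "real mat"

definition pl_out :: "plant \<Rightarrow> ix \<Rightarrow> nat" where
  "pl_out G i = (case i of St \<Rightarrow> n_st G | Ch \<Rightarrow> n_z G)"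

definition pl_in :: "plant \<Rightarrow> ix \<Rightarrow> nat" where
  "pl_in G j = (case j of St \<Rightarrow> n_st G | Ch \<Rightarrow> n_w G)"

definition plant_sizes :: "plant \<Rightarrow> bool" where
  "plant_sizes G \<longleftrightarrow>
     (\<forall>i j. plA G i j \<in> carrier_mat (pl_out G i) (pl_in G j)) \<and>
     (\<forall>i. plBp G i \<in> carrier_mat (pl_out G i) (n_wp G)) \<and>
     (\<forall>i. plB G i \<in> carrier_mat (pl_out G i) (n_u G)) \<and>
     (\<forall>j. plCp G j \<in> carrier_mat (n_zp G) (pl_in G j)) \<and>
     (\<forall>j. plC G j \<in> carrier_mat (n_y G) (pl_in G j)) \<and>
     plDp G \<in> carrier_mat (n_zp G) (n_wp G) \<and>
     plD1 G \<in> carrier_mat (n_zp G) (n_u G) \<and>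
     plD2 G \<in> carrier_mat (n_y G) (n_wp G)"

text \<open>
  The original plant. Since the values of the uncertainty have the form \<open>diag(V, V)\<close> with
  one and the same \<open>nu \<times> nv\<close> matrix, both parts of \<open>w\<close> have size \<open>nu\<close> and both
  parts of \<open>z\<close> have size \<open>nv\<close>.
\<close>

definition structured_plant :: "nat \<Rightarrow> nat \<Rightarrow> plant \<Rightarrow> bool" where
  "structured_plant nu nv G \<longleftrightarrow>
     plant_sizes G \<and> n_w G = nu + nu \<and> n_z G = nv + nv \<and>
     plDp G = 0\<^sub>m (n_zp G) (n_wp G) \<and>
     (\<exists>A22 \<in> carrier_mat nv nu. \<exists>A32 \<in> carrier_mat nv nu. \<exists>A33 \<in> carrier_mat nv nu.
        plA G Ch Ch = block_mat [[A22, 0\<^sub>m nv nu], [A32, A33]]) \<and>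
     (\<exists>B3 \<in> carrier_mat nv (n_wp G). plBp G Ch = block_mat [[0\<^sub>m nv (n_wp G)], [B3]]) \<and>
     (\<exists>C2 \<in> carrier_mat (n_zp G) nu. plCp G Ch = block_mat [[C2, 0\<^sub>m (n_zp G) nu]])"

definition value_set :: "nat \<Rightarrow> nat \<Rightarrow> nat \<Rightarrow> (nat \<Rightarrow> real mat) \<Rightarrow> real mat set \<Rightarrow> bool" where
  "value_set nu nv N \<Delta> \<V> \<longleftrightarrow>
     (\<forall>l<N. \<Delta> l \<in> carrier_mat (nu + nu) (nv + nv)) \<and>
     \<V> = mat_hull (nu + nu) (nv + nv) N \<Delta> \<and>
     0\<^sub>m (nu + nu) (nv + nv) \<in> \<V> \<and>
     (\<forall>V \<in> \<V>. \<exists>W \<in> carrier_mat nu nv. V = block_mat [[W, 0\<^sub>m nu nv], [0\<^sub>m nu nv, W]])"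

definition lifted_plant :: "plant \<Rightarrow> plant" where
  "lifted_plant G = (let u = n_w G; v = n_z G in
     G\<lparr>n_w := u + v, n_z := u + v,
       plA := (\<lambda>i j. case (i, j) of
           (St, St) \<Rightarrow> plA G St St
         | (St, Ch) \<Rightarrow> block_mat [[plA G St Ch, 0\<^sub>m (n_st G) v]]
         | (Ch, St) \<Rightarrow> block_mat [[0\<^sub>m u (n_st G)], [2 \<cdot>\<^sub>m plA G Ch St]]
         | (Ch, Ch) \<Rightarrow> block_mat [[1\<^sub>m u, 0\<^sub>m u v], [2 \<cdot>\<^sub>m plA G Ch Ch, - 1\<^sub>m v]]),
       plBp := (\<lambda>i. case i of St \<Rightarrow> plBp G St
         | Ch \<Rightarrow> block_mat [[0\<^sub>m u (n_wp G)], [2 \<cdot>\<^sub>m plBp G Ch]]),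
       plB := (\<lambda>i. case i of St \<Rightarrow> plB G St
         | Ch \<Rightarrow> block_mat [[0\<^sub>m u (n_u G)], [2 \<cdot>\<^sub>m plB G Ch]]),
       plCp := (\<lambda>j. case j of St \<Rightarrow> plCp G St
         | Ch \<Rightarrow> block_mat [[plCp G Ch, 0\<^sub>m (n_zp G) v]]),
       plC := (\<lambda>j. case j of St \<Rightarrow> plC G St
         | Ch \<Rightarrow> block_mat [[plC G Ch, 0\<^sub>m (n_y G) v]])\<rparr>)"

text \<open>The lifted uncertainty \<open>\<Delta>\<^sub>l(V)\<close>.\<close>

definition lift_unc :: "real mat \<Rightarrow> real mat" where
  "lift_unc V =
     block_mat [[- 1\<^sub>m (dim_row V), 2 \<cdot>\<^sub>m V], [0\<^sub>m (dim_col V) (dim_row V), 1\<^sub>m (dim_col V)]]"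


section \<open>Controllers\<close>

text \<open>The field \<open>sched\<close> is the scheduling function \<open>\<Delta>\<^sub>c\<close>; only its values on \<open>\<V>\<close> matter.\<close>

record controller =
  n_co :: nat
  r_co1 :: nat
  r_co2 :: nat
  coA :: "ix \<Rightarrow> ix \<Rightarrow> real mat"
  coB :: "ix \<Rightarrow> real mat"
  coC :: "ix \<Rightarrow> real mat"
  coD :: "real mat"
  sched :: "real mat \<Rightarrow> real mat"

definition r_co :: "controller \<Rightarrow> nat" where
  "r_co K = r_co1 K + r_co2 K"

definition co_dim :: "controller \<Rightarrow> ix \<Rightarrow> nat" where
  "co_dim K i = (case i of St \<Rightarrow> n_co K | Ch \<Rightarrow> r_co K)"

definition structured_controller :: "nat \<Rightarrow> nat \<Rightarrow> real mat set \<Rightarrow> controller \<Rightarrow> bool" where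
  "structured_controller m k \<V> K \<longleftrightarrow> (let r1 = r_co1 K; r2 = r_co2 K in
     (\<forall>i j. coA K i j \<in> carrier_mat (co_dim K i) (co_dim K j)) \<and>
     (\<forall>i. coB K i \<in> carrier_mat (co_dim K i) k) \<and>
     (\<forall>j. coC K j \<in> carrier_mat m (co_dim K j)) \<and>
     (\<exists>A22 \<in> carrier_mat r1 r1. \<exists>A32 \<in> carrier_mat r2 r1. \<exists>A33 \<in> carrier_mat r2 r2.
        coA K Ch Ch = block_mat [[A22, 0\<^sub>m r1 r2], [A32, A33]]) \<and>
     (\<exists>B3 \<in> carrier_mat r2 k. coB K Ch = block_mat [[0\<^sub>m r1 k], [B3]]) \<and>
     (\<exists>C2 \<in> carrier_mat m r1. coC K Ch = block_mat [[C2, 0\<^sub>m m r2]]) \<and>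
     coD K = 0\<^sub>m m k \<and>
     (\<forall>V \<in> \<V>. \<exists>D11 \<in> carrier_mat r1 r1. \<exists>D21 \<in> carrier_mat r2 r1. \<exists>D22 \<in> carrier_mat r2 r2.
        sched K V = block_mat [[D11, 0\<^sub>m r1 r2], [D21, D22]]))"


section \<open>Closed loop\<close>

definition cl_mat :: "plant \<Rightarrow> controller \<Rightarrow> ix \<Rightarrow> ix \<Rightarrow> real mat" where
  "cl_mat G K i j =
     block_mat
       [[plA G i j, 0\<^sub>m (pl_out G i) (co_dim K j), plBp G i],
        [0\<^sub>m (co_dim K i) (pl_in G j), 0\<^sub>m (co_dim K i) (co_dim K j), 0\<^sub>m (co_dim K i) (n_wp G)],
        [plCp G j, 0\<^sub>m (n_zp G) (co_dim K j), plDp G]]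
     + block_mat
       [[0\<^sub>m (pl_out G i) (co_dim K i), plB G i],
        [1\<^sub>m (co_dim K i), 0\<^sub>m (co_dim K i) (n_u G)],
        [0\<^sub>m (n_zp G) (co_dim K i), plD1 G]]
     * block_mat
       [[coA K i j, coB K i],
        [coC K j, coD K]]
     * block_mat
       [[0\<^sub>m (co_dim K j) (pl_in G j), 1\<^sub>m (co_dim K j), 0\<^sub>m (co_dim K j) (n_wp G)],
        [plC G j, 0\<^sub>m (n_y G) (co_dim K j), plD2 G]]"

text \<open>
  The four blocks of \<open>cl_mat G K i j\<close>. The right blocks do not depend on \<open>j\<close> and the lower
  blocks do not depend on \<open>i\<close> (see \<open>cl_split_eq\<close> below), so the choice of \<open>St\<close> for the missing index is
  immaterial.
\<close>

definition cl_split :: "plant \<Rightarrow> controller \<Rightarrow> ix \<Rightarrow> ix \<Rightarrow> real mat \<times> real mat \<times> real mat \<times> real mat"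
  where "cl_split G K i j =
    split_block (cl_mat G K i j) (pl_out G i + co_dim K i) (pl_in G j + co_dim K j)"

definition clA :: "plant \<Rightarrow> controller \<Rightarrow> ix \<Rightarrow> ix \<Rightarrow> real mat" where
  "clA G K i j = (case cl_split G K i j of (A, B, C, D) \<Rightarrow> A)"

definition clB :: "plant \<Rightarrow> controller \<Rightarrow> ix \<Rightarrow> real mat" where
  "clB G K i = (case cl_split G K i St of (A, B, C, D) \<Rightarrow> B)"

definition clC :: "plant \<Rightarrow> controller \<Rightarrow> ix \<Rightarrow> real mat" where
  "clC G K j = (case cl_split G K St j of (A, B, C, D) \<Rightarrow> C)"

definition clD :: "plant \<Rightarrow> controller \<Rightarrow> real mat" where
  "clD G K = (case cl_split G K St St of (A, B, C, D) \<Rightarrow> D)"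

lemma cl_sizes:
  assumes "plant_sizes G" "structured_controller (n_u G) (n_y G) \<V> K"
  shows "plA G i j \<in> carrier_mat (pl_out G i) (pl_in G j)"
    "plBp G i \<in> carrier_mat (pl_out G i) (n_wp G)"
    "plB G i \<in> carrier_mat (pl_out G i) (n_u G)"
    "plCp G j \<in> carrier_mat (n_zp G) (pl_in G j)"
    "plC G j \<in> carrier_mat (n_y G) (pl_in G j)"
    "plDp G \<in> carrier_mat (n_zp G) (n_wp G)"
    "plD1 G \<in> carrier_mat (n_zp G) (n_u G)"
    "plD2 G \<in> carrier_mat (n_y G) (n_wp G)"
    "coA K i j \<in> carrier_mat (co_dim K i) (co_dim K j)"
    "coB K i \<in> carrier_mat (co_dim K i) (n_y G)"
    "coC K j \<in> carrier_mat (n_u G) (co_dim K j)"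
    "coD K \<in> carrier_mat (n_u G) (n_y G)"
  using assms by (auto simp: plant_sizes_def structured_controller_def Let_def)

lemma cl_mat_eq:
  assumes "plant_sizes G" "structured_controller (n_u G) (n_y G) \<V> K"
  shows "cl_mat G K i j = block_mat
    [[plA G i j + plB G i * coD K * plC G j, plB G i * coC K j, plBp G i + plB G i * coD K * plD2 G],
     [coB K i * plC G j, coA K i j, coB K i * plD2 G],
     [plCp G j + plD1 G * coD K * plC G j, plD1 G * coC K j, plDp G + plD1 G * coD K * plD2 G]]"
proof -
  note d = cl_sizes[OF assms]
  note d' = d[THEN carrier_matD(1)] d[THEN carrier_matD(2)]
  show ?thesis
    unfolding cl_mat_def block_mat_def block_row_def
    by (simp add: append_simps d')
qed

lemma cl_split_eq:
  assumes "plant_sizes G" "structured_controller (n_u G) (n_y G) \<V> K"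
  shows "cl_split G K i j =
    (block_mat [[plA G i j + plB G i * coD K * plC G j, plB G i * coC K j],
                [coB K i * plC G j, coA K i j]],
     block_mat [[plBp G i + plB G i * coD K * plD2 G], [coB K i * plD2 G]],
     block_mat [[plCp G j + plD1 G * coD K * plC G j, plD1 G * coC K j]],
     plDp G + plD1 G * coD K * plD2 G)" (is "_ = (?A, ?B, ?C, ?D)")
proof -
  note d = cl_sizes[OF assms]
  note d' = d[THEN carrier_matD(1)] d[THEN carrier_matD(2)]
  have "cl_mat G K i j = append_cols ?A ?B @\<^sub>r append_cols ?C ?D"
    unfolding cl_mat_eq[OF assms] block_mat_def block_row_def
    by (simp add: append_cols_dims append_rows_dims append_empty append_swap[symmetric] append_cols_assoc append_rows_assoc d')
  moreover have "dim_row ?A = pl_out G i + co_dim K i" "dim_col ?A = pl_in G j + co_dim K j"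
     "dim_row ?B = pl_out G i + co_dim K i" "dim_row ?C = n_zp G" "dim_row ?D = n_zp G"
     "dim_col ?C = pl_in G j + co_dim K j"  "dim_col ?B = n_wp G" "dim_col ?D = n_wp G"
    by (simp_all add: block_mat_def block_row_def append_cols_dims append_rows_dims append_empty d')
  ultimately show ?thesis
    unfolding cl_split_def using split_block_append[of ?A ?B ?C ?D] by simp
qed


section \<open>The matrix expressions in the inequalities\<close>

definition outer_F :: "(ix \<Rightarrow> ix \<Rightarrow> real mat) \<Rightarrow> (ix \<Rightarrow> real mat) \<Rightarrow> (ix \<Rightarrow> real mat) \<Rightarrow> real mat \<Rightarrow> real mat"
  where "outer_F A B C D =
    (let n = dim_col (A St St); q = dim_col (A St Ch); p = dim_col D in
     block_mat
       [[1\<^sub>m n, 0\<^sub>m n q, 0\<^sub>m n p],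
        [A St St, A St Ch, B St],
        [0\<^sub>m q n, 1\<^sub>m q, 0\<^sub>m q p],
        [A Ch St, A Ch Ch, B Ch],
        [0\<^sub>m p n, 0\<^sub>m p q, 1\<^sub>m p],
        [C St, C Ch, D]])"

text \<open>The same without the third block column; \<open>p\<close> is the size of the performance input.\<close>

definition outer_F_sub :: "nat \<Rightarrow> (ix \<Rightarrow> ix \<Rightarrow> real mat) \<Rightarrow> (ix \<Rightarrow> real mat) \<Rightarrow> real mat"
  where "outer_F_sub p A C =
    (let n = dim_col (A St St); q = dim_col (A St Ch) in
     block_mat
       [[1\<^sub>m n, 0\<^sub>m n q],
        [A St St, A St Ch],
        [0\<^sub>m q n, 1\<^sub>m q],
        [A Ch St, A Ch Ch],
        [0\<^sub>m p n, 0\<^sub>m p q],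
        [C St, C Ch]])"

definition lmi :: "real mat \<Rightarrow> real mat \<Rightarrow> real mat \<Rightarrow> (ix \<Rightarrow> ix \<Rightarrow> real mat) \<Rightarrow> (ix \<Rightarrow> real mat) \<Rightarrow>
    (ix \<Rightarrow> real mat) \<Rightarrow> real mat \<Rightarrow> real mat"
  where "lmi X R S A B C D =
    (outer_F A B C D)\<^sup>T * diag_block_mat [X, R, S] * outer_F A B C D"

definition lmi_sub :: "nat \<Rightarrow> real mat \<Rightarrow> real mat \<Rightarrow> real mat \<Rightarrow> (ix \<Rightarrow> ix \<Rightarrow> real mat) \<Rightarrow>
    (ix \<Rightarrow> real mat) \<Rightarrow> real mat"
  where "lmi_sub p X R S A C =
    (outer_F_sub p A C)\<^sup>T * diag_block_mat [X, R, S] * outer_F_sub p A C"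

text \<open>The matrix with zero diagonal blocks and off-diagonal blocks \<open>M\<close>, for square \<open>M\<close>.\<close>

definition off_diag :: "real mat \<Rightarrow> real mat" where
  "off_diag M = (let n = dim_row M in block_mat [[0\<^sub>m n n, M], [M, 0\<^sub>m n n]])"

definition neg_first :: "real mat \<Rightarrow> real mat" where
  "neg_first M = (let n = dim_row M in block_mat [[- M, 0\<^sub>m n n], [0\<^sub>m n n, 0\<^sub>m n n]])"

definition P_Z :: "nat \<Rightarrow> real mat \<Rightarrow> real mat" where
  "P_Z p Z = (let q = dim_row Z in
     block_mat [[0\<^sub>m p p, 0\<^sub>m p q], [0\<^sub>m q p, the (mat_inverse Z)]])"

definition P_gamma :: "nat \<Rightarrow> nat \<Rightarrow> real \<Rightarrow> real mat" where
  "P_gamma p q \<gamma> = block_mat [[(- \<gamma>) \<cdot>\<^sub>m 1\<^sub>m p, 0\<^sub>m p q], [0\<^sub>m q p, 0\<^sub>m q q]]"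

text \<open>The uncertainties \<open>\<Delta>\<^sub>l\<^sub>c(V)\<close> and \<open>\<Delta>\<^sub>e\<^sub>x(V)\<close> of the closed loops.\<close>

definition unc_lc :: "controller \<Rightarrow> real mat \<Rightarrow> real mat" where
  "unc_lc K V = diag_block_mat [lift_unc V, sched K V]"

definition unc_ex :: "controller \<Rightarrow> real mat \<Rightarrow> real mat" where
  "unc_ex K V = diag_block_mat [V, sched K V]"

definition scalings :: "plant \<Rightarrow> real mat set \<Rightarrow> controller \<Rightarrow> real mat set" where
  "scalings G \<V> K =
     {P \<in> sym_mats (n_w G + n_z G + r_co K). \<forall>V \<in> \<V>. pos_def (He (P * unc_lc K V))}"

end

theory Submission
  imports Defs "Jordan_Normal_Form.Determinant"
begin

text \<open>
  The lifted uncertainty channel has an extra input \<open>w\<^sub>2\<close>, which only enters through the output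
  \<open>z\<^sub>2 = 2 z - w\<^sub>2\<close>, where \<open>z\<close> is the output of the original channel. Substituting \<open>w\<^sub>2 = z\<close> thus turns
  the lifted input and output of the scaling into \<open>(w, z, w\<^sub>c)\<close> and \<open>(w, z, z\<^sub>c)\<close>, so it is an injective
  congruence from the lifted inequalities to those of the original loop with the scaling
  \<open>2 (w, z, z\<^sub>c)\<^sup>T P (w, z, w\<^sub>c)\<close>, a quadratic form in \<open>(w, w\<^sub>c, z, z\<^sub>c)\<close>. For \<open>w = V z\<close> the lifted
  uncertainty fixes \<open>(w, z)\<close>, since \<open>- w + 2 V z = w\<close>; therefore positivity of the new scaling on the
  graph of the uncertainty is inherited from \<open>He (P \<Delta>\<^sub>l\<^sub>c(V))\<close>.
\<close>

section \<open>Block matrix calculus\<close>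

lemma append_carrier:
  "A \<in> carrier_mat m n \<Longrightarrow> B \<in> carrier_mat m k \<Longrightarrow> append_cols A B \<in> carrier_mat m (n + k)"
  "C \<in> carrier_mat m n \<Longrightarrow> D \<in> carrier_mat k n \<Longrightarrow> C @\<^sub>r D \<in> carrier_mat (m + k) n"
  for A B C D :: "real mat"
  by (auto simp: append_cols_dims append_rows_dims)

lemma transpose_append:
  "dim_row A = dim_row B \<Longrightarrow> (append_cols A B)\<^sup>T = A\<^sup>T @\<^sub>r B\<^sup>T"
  "dim_col C = dim_col D \<Longrightarrow> (C @\<^sub>r D)\<^sup>T = append_cols C\<^sup>T D\<^sup>T"
  for A B C D :: "real mat"
  by (rule eq_matI; auto simp: append_cols_dims append_rows_dims append_cols_index append_rows_index)+

lemma four_block_mat_append: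
  assumes "dim_row A = dim_row B" "dim_row C = dim_row D" "dim_col A = dim_col C" "dim_col B = dim_col D"
  shows "four_block_mat A B C D = append_cols A B @\<^sub>r append_cols C D"
  using assms
  by (intro eq_matI) (auto simp: append_cols_dims append_rows_dims append_cols_index append_rows_index)

lemma zero_mat_append:
  "append_cols (0\<^sub>m m n) (0\<^sub>m m k) = (0\<^sub>m m (n + k) :: real mat)"
  "0\<^sub>m m n @\<^sub>r 0\<^sub>m k n = (0\<^sub>m (m + k) n :: real mat)"
  by (rule eq_matI; simp add: append_cols_dims append_rows_dims append_cols_index append_rows_index)+

lemma one_mat_append:
  "(1\<^sub>m (m + n) :: real mat) = append_cols (1\<^sub>m m) (0\<^sub>m m n) @\<^sub>r append_cols (0\<^sub>m n m) (1\<^sub>m n)"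
  by (rule eq_matI) (auto simp: append_cols_dims append_rows_dims append_cols_index append_rows_index)

text \<open>Brings block diagonals into the append form on which the rules of
  \<open>append_simps\<close> compute. Three blocks are nested as \<open>A\<close> against the pair
  \<open>B\<close>, \<open>C\<close>.\<close>

lemma diag_block_mat_append:
  fixes A B C :: "real mat"
  shows "diag_block_mat [A, B] = append_cols A (0\<^sub>m (dim_row A) (dim_col B)) @\<^sub>r
      append_cols (0\<^sub>m (dim_row B) (dim_col A)) B"
    "diag_block_mat [A, B, C] =
      append_cols A (0\<^sub>m (dim_row A) (dim_col B + dim_col C)) @\<^sub>r
      append_cols (0\<^sub>m (dim_row B + dim_row C) (dim_col A)) (append_cols B (0\<^sub>m (dim_row B) (dim_col C)) @\<^sub>r
        append_cols (0\<^sub>m (dim_row C) (dim_col B)) C)"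
proof -
  have one: "diag_block_mat [M] = M" for M :: "real mat"
    by (rule eq_matI) (simp_all add: Let_def)
  have cons: "diag_block_mat (M # Ms) =
      append_cols M (0\<^sub>m (dim_row M) (dim_col (diag_block_mat Ms))) @\<^sub>r
      append_cols (0\<^sub>m (dim_row (diag_block_mat Ms)) (dim_col M)) (diag_block_mat Ms)"
    for M :: "real mat" and Ms
    by (simp add: Let_def four_block_mat_append)
  show two: "diag_block_mat [A, B] = append_cols A (0\<^sub>m (dim_row A) (dim_col B)) @\<^sub>r
      append_cols (0\<^sub>m (dim_row B) (dim_col A)) B" for A B :: "real mat"
    by (simp only: cons[of A "[B]"] one)
  show "diag_block_mat [A, B, C] =
      append_cols A (0\<^sub>m (dim_row A) (dim_col B + dim_col C)) @\<^sub>r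
      append_cols (0\<^sub>m (dim_row B + dim_row C) (dim_col A)) (append_cols B (0\<^sub>m (dim_row B) (dim_col C)) @\<^sub>r
        append_cols (0\<^sub>m (dim_row C) (dim_col B)) C)"
    by (simp only: cons[of A "[B, C]"] two append_cols_dims append_rows_dims index_zero_mat)
qed

text \<open>The two cancellations behind the lifting: \<open>2 z - w_2 = z\<close> for
  \<open>w_2 = z\<close>, and \<open>- w + 2 V z = w\<close> for \<open>w = V z\<close>.\<close>

lemma two_smult_minus: "2 \<cdot>\<^sub>m A + - A = A" "- A + 2 \<cdot>\<^sub>m A = A" for A :: "real mat"
  by (rule eq_matI; simp)+

section \<open>Congruence and definiteness\<close>

lemma transpose_sandwich:
  fixes M T U :: "real mat"
  assumes "M \<in> carrier_mat m m" "T \<in> carrier_mat m n" "U \<in> carrier_mat n k"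
  shows "U\<^sup>T * (T\<^sup>T * M * T) * U = (T * U)\<^sup>T * M * (T * U)"
proof -
  have "U\<^sup>T * (T\<^sup>T * M * T) = U\<^sup>T * T\<^sup>T * M * T"
    using assms assoc_mult_mat[of "U\<^sup>T" k n "T\<^sup>T * M" m T n] assoc_mult_mat[of "U\<^sup>T" k n "T\<^sup>T" m M m]
    by auto
  moreover have "U\<^sup>T * T\<^sup>T * M * T * U = U\<^sup>T * T\<^sup>T * M * (T * U)"
    using assms by (intro assoc_mult_mat[of _ k m _ n _ k]) auto
  ultimately show ?thesis
    using transpose_mult[OF assms(2,3)] by simp
qed

lemma sym_mats_congruence:
  assumes "M \<in> sym_mats m" "T \<in> carrier_mat m n"
  shows "T\<^sup>T * M * T \<in> sym_mats n"
proof -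
  have M: "M \<in> carrier_mat m m" "M\<^sup>T = M" using assms(1) by (auto simp: sym_mats_def)
  have "(T\<^sup>T * M * T)\<^sup>T = T\<^sup>T * (T\<^sup>T * M)\<^sup>T"
    using M assms by (intro transpose_mult[of _ n m]) auto
  also have "(T\<^sup>T * M)\<^sup>T = M\<^sup>T * T\<^sup>T\<^sup>T"
    using M assms by (intro transpose_mult[of _ n m]) auto
  finally show ?thesis
    using M assms by (simp add: sym_mats_def)
qed

lemma congruence_form:
  fixes M T :: "real mat"
  assumes "M \<in> carrier_mat m m" "T \<in> carrier_mat m n" "x \<in> carrier_vec n"
  shows "x \<bullet> ((T\<^sup>T * M * T) *\<^sub>v x) = (T *\<^sub>v x) \<bullet> (M *\<^sub>v (T *\<^sub>v x))"
proof -
  have "(T\<^sup>T * M * T) *\<^sub>v x = T\<^sup>T *\<^sub>v (M *\<^sub>v (T *\<^sub>v x))"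
    using assms by (simp add: assoc_mult_mat_vec[of _ n m _ n] assoc_mult_mat_vec[of _ n m _ m])
  then show ?thesis
    using assms transpose_vec_mult_scalar[of T m n x "M *\<^sub>v (T *\<^sub>v x)"]
    by (metis comm_scalar_prod mult_mat_vec_carrier transpose_carrier_mat)
qed

lemma left_inverse_mult_vec:
  fixes T L :: "real mat"
  assumes "T \<in> carrier_mat m n" "L \<in> carrier_mat n m" "L * T = 1\<^sub>m n" "x \<in> carrier_vec n" "x \<noteq> 0\<^sub>v n"
  shows "T *\<^sub>v x \<noteq> 0\<^sub>v m"
proof
  assume "T *\<^sub>v x = 0\<^sub>v m"
  then have "(L * T) *\<^sub>v x = L *\<^sub>v 0\<^sub>v m"
    using assms(1,2,4) by (simp add: assoc_mult_mat_vec[of _ n m _ n])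
  then show False using assms by auto
qed

text \<open>A congruence keeps a form strictly definite when \<open>T\<close> is injective.
  Injectivity is expressed by a left inverse \<open>L\<close>, since in each use one can be written
  down: it deletes the components that \<open>T\<close> has added.\<close>

lemma def_congruence:
  assumes "M \<in> carrier_mat m m" "T \<in> carrier_mat m n" "L \<in> carrier_mat n m" "L * T = 1\<^sub>m n"
  shows "pos_def M \<Longrightarrow> pos_def (T\<^sup>T * M * T)" "neg_def M \<Longrightarrow> neg_def (T\<^sup>T * M * T)"
proof -
  note form = congruence_form[OF assms(1,2)] and nz = left_inverse_mult_vec[OF assms(2-4)]
  have dim: "dim_row (T\<^sup>T * M * T) = n" "dim_row M = m"
    and T: "x \<in> carrier_vec n \<Longrightarrow> T *\<^sub>v x \<in> carrier_vec m" for x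
    using assms by auto
  show "pos_def (T\<^sup>T * M * T)" if "pos_def M"
    unfolding pos_def_def dim
  proof (intro conjI ballI impI)
    show "T\<^sup>T * M * T \<in> sym_mats n"
      using that by (intro sym_mats_congruence[OF _ assms(2)]) (simp add: pos_def_def dim)
    show "0 < x \<bullet> ((T\<^sup>T * M * T) *\<^sub>v x)" if "x \<in> carrier_vec n" "x \<noteq> 0\<^sub>v n" for x
      using \<open>pos_def M\<close> T[OF that(1)] nz[OF that]
      unfolding form[OF that(1)] pos_def_def dim by blast
  qed
  show "neg_def (T\<^sup>T * M * T)" if "neg_def M"
    unfolding neg_def_def dim
  proof (intro conjI ballI impI)
    show "T\<^sup>T * M * T \<in> sym_mats n"
      using that by (intro sym_mats_congruence[OF _ assms(2)]) (simp add: neg_def_def dim)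
    show "x \<bullet> ((T\<^sup>T * M * T) *\<^sub>v x) < 0" if "x \<in> carrier_vec n" "x \<noteq> 0\<^sub>v n" for x
      using \<open>neg_def M\<close> T[OF that(1)] nz[OF that]
      unfolding form[OF that(1)] neg_def_def dim by blast
  qed
qed

text \<open>The block \<open>the (mat_inverse Z)\<close> of \<open>P_Z\<close> has a known size only
  once the option is not \<open>None\<close>. A singular \<open>Z\<close> would have a nonzero
  kernel vector, on which its quadratic form vanishes.\<close>

lemma pos_def_mat_inverse_carrier:
  assumes "pos_def Z" "Z \<in> carrier_mat n n"
  shows "the (mat_inverse Z) \<in> carrier_mat n n"
proof (cases "mat_inverse Z")
  case None
  then have "det Z = 0"
    \<comment> \<open>The value \<open>()\<close> fills the free slot of the matrix ring record, so
      that both facts speak of the units of the same ring.\<close>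
    using mat_inverse(1)[OF assms(2) None, of "()"] det_non_zero_imp_unit[OF assms(2), of "()"] by auto
  then obtain v where "v \<in> carrier_vec n" "v \<noteq> 0\<^sub>v n" "Z *\<^sub>v v = 0\<^sub>v n"
    using det_0_iff_vec_prod_zero[OF assms(2)] by auto
  then show ?thesis using assms unfolding pos_def_def by fastforce
next
  case (Some B)
  then show ?thesis using mat_inverse(2)[OF assms(2) Some] by simp
qed


section \<open>Block-diagonal weights and the channel map\<close>

lemma diag_block_mat_carrier:
  fixes A B C :: "real mat"
  assumes "A \<in> carrier_mat a a'" "B \<in> carrier_mat b b'" "C \<in> carrier_mat c c'"
  shows "diag_block_mat [A, B, C] \<in> carrier_mat (a + (b + c)) (a' + (b' + c'))"
  using assms by (auto simp: diag_block_mat_append append_cols_dims append_rows_dims)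

text \<open>Pulling a channel map into the weight changes the middle block only. With
  \<open>lift_wz\<close> for \<open>E\<close> and the lifted scaling for \<open>R\<close>, the new
  middle block is the scaling of the original loop.\<close>

lemma diag_block_congruence:
  fixes E R S X :: "real mat"
  assumes "X \<in> carrier_mat k k" "R \<in> carrier_mat m m" "S \<in> carrier_mat l l" "E \<in> carrier_mat m n"
  shows "(diag_block_mat [1\<^sub>m k, E, 1\<^sub>m l])\<^sup>T * diag_block_mat [X, R, S] * diag_block_mat [1\<^sub>m k, E, 1\<^sub>m l] =
    diag_block_mat [X, E\<^sup>T * R * E, S]"
proof -
  note d = assms[THEN carrier_matD(1)] assms[THEN carrier_matD(2)]
  show ?thesis
    unfolding diag_block_mat_append using d
    by (simp add: transpose_append append_simps zero_mat_append flip: append_swap)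
qed

lemma diag_block_mult_append_rows:
  fixes E F1 F2 F3 :: "real mat"
  assumes "F1 \<in> carrier_mat k c" "F2 \<in> carrier_mat n c" "F3 \<in> carrier_mat l c" "E \<in> carrier_mat m n"
  shows "diag_block_mat [1\<^sub>m k, E, 1\<^sub>m l] * (F1 @\<^sub>r F2 @\<^sub>r F3) = F1 @\<^sub>r (E * F2) @\<^sub>r F3"
proof -
  note d = assms[THEN carrier_matD(1)] assms[THEN carrier_matD(2)]
  show ?thesis
    unfolding diag_block_mat_append using d
    by (simp add: append_simps zero_mat_append)
qed

text \<open>
  The maps \<open>(w, w\<^sub>c, z, z\<^sub>c) \<mapsto> (w, z, w\<^sub>c)\<close> and \<open>(w, w\<^sub>c, z, z\<^sub>c) \<mapsto> (w, z, z\<^sub>c)\<close>.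
\<close>

definition lift_w :: "nat \<Rightarrow> nat \<Rightarrow> nat \<Rightarrow> real mat" where
  "lift_w u v r = block_mat
     [[1\<^sub>m u, 0\<^sub>m u r, 0\<^sub>m u v, 0\<^sub>m u r],
      [0\<^sub>m v u, 0\<^sub>m v r, 1\<^sub>m v, 0\<^sub>m v r],
      [0\<^sub>m r u, 1\<^sub>m r, 0\<^sub>m r v, 0\<^sub>m r r]]"

definition lift_z :: "nat \<Rightarrow> nat \<Rightarrow> nat \<Rightarrow> real mat" where
  "lift_z u v r = block_mat
     [[1\<^sub>m u, 0\<^sub>m u r, 0\<^sub>m u v, 0\<^sub>m u r],
      [0\<^sub>m v u, 0\<^sub>m v r, 1\<^sub>m v, 0\<^sub>m v r],
      [0\<^sub>m r u, 0\<^sub>m r r, 0\<^sub>m r v, 1\<^sub>m r]]"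

text \<open>The lifted input is stacked over the lifted output, the order in which
  \<open>off_diag P\<close> pairs them.\<close>

definition lift_wz :: "nat \<Rightarrow> nat \<Rightarrow> nat \<Rightarrow> real mat" where
  "lift_wz u v r = block_mat [[lift_w u v r], [lift_z u v r]]"

lemma lift_wz_carrier:
  "lift_wz u v r \<in> carrier_mat ((u + v + r) + (u + v + r)) (u + r + v + r)"
  by (intro carrier_matI)
    (simp_all add: lift_wz_def lift_w_def lift_z_def block_mat_def block_row_def append_cols_dims append_rows_dims)

text \<open>After \<open>w_2 = z\<close> the pair \<open>(w, z)\<close> is both the plant part of
  the lifted input and that of the lifted output, so \<open>W1\<close> and \<open>Z1\<close> occur
  twice; only the scheduling parts \<open>W2\<close> and \<open>Z2\<close> differ.\<close>

lemma lift_wz_mult: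
  assumes "W1 \<in> carrier_mat u n" "W2 \<in> carrier_mat r n" "Z1 \<in> carrier_mat v n" "Z2 \<in> carrier_mat r n"
  shows "lift_wz u v r * (W1 @\<^sub>r W2 @\<^sub>r Z1 @\<^sub>r Z2) =
    (W1 @\<^sub>r Z1 @\<^sub>r W2) @\<^sub>r (W1 @\<^sub>r Z1 @\<^sub>r Z2)"
proof -
  note d = assms[THEN carrier_matD(1)] assms[THEN carrier_matD(2)]
  show ?thesis
    by (simp add: lift_wz_def lift_w_def lift_z_def block_mat_def block_row_def append_simps d)
qed

section \<open>The congruence between the lifted and the original loop\<close>

text \<open>
  A letter \<open>t\<close> marks the rows of the output \<open>z\<close> of the original channel, \<open>b\<close> those of the scheduling
  output \<open>z\<^sub>c\<close>; \<open>a\<close> and \<open>c\<close> mark the state and performance rows. The second letter is the column: state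
  \<open>x\<close>, uncertainty input \<open>w\<close>, scheduling input \<open>c\<close>, performance input \<open>p\<close>.
\<close>

locale lifted_loop =
  fixes n u v r p q :: nat
    and aw ac tx tw tc tp bx bw bc bp cw cc D :: "real mat"
    and A A' :: "ix \<Rightarrow> ix \<Rightarrow> real mat" and B B' C C' :: "ix \<Rightarrow> real mat"
  assumes carrier:
    "A St St \<in> carrier_mat n n" "B St \<in> carrier_mat n p" "C St \<in> carrier_mat q n" "D \<in> carrier_mat q p"
    "aw \<in> carrier_mat n u" "ac \<in> carrier_mat n r" "tx \<in> carrier_mat v n" "bx \<in> carrier_mat r n"
    "tw \<in> carrier_mat v u" "tc \<in> carrier_mat v r" "bw \<in> carrier_mat r u" "bc \<in> carrier_mat r r"
    "tp \<in> carrier_mat v p" "bp \<in> carrier_mat r p" "cw \<in> carrier_mat q u" "cc \<in> carrier_mat q r"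
  and original:
    "A St Ch = append_cols aw ac"
    "A Ch St = tx @\<^sub>r bx"
    "A Ch Ch = append_cols tw tc @\<^sub>r append_cols bw bc"
    "B Ch = tp @\<^sub>r bp"
    "C Ch = append_cols cw cc"
  and lifted:
    "A' St St = A St St"
    "A' St Ch = append_cols aw (append_cols (0\<^sub>m n v) ac)"
    "A' Ch St = 0\<^sub>m u n @\<^sub>r 2 \<cdot>\<^sub>m tx @\<^sub>r bx"
    "A' Ch Ch = append_cols (1\<^sub>m u) (append_cols (0\<^sub>m u v) (0\<^sub>m u r)) @\<^sub>r
      append_cols (2 \<cdot>\<^sub>m tw) (append_cols (- 1\<^sub>m v) (2 \<cdot>\<^sub>m tc)) @\<^sub>r
      append_cols bw (append_cols (0\<^sub>m r v) bc)"
    "B' St = B St"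
    "B' Ch = 0\<^sub>m u p @\<^sub>r 2 \<cdot>\<^sub>m tp @\<^sub>r bp"
    "C' St = C St"
    "C' Ch = append_cols cw (append_cols (0\<^sub>m q v) cc)"
begin

lemmas dims = carrier[THEN carrier_matD(1)] carrier[THEN carrier_matD(2)]
lemmas defs = original lifted block_mat_def block_row_def

text \<open>\<open>T\<close> inserts \<open>w\<^sub>2 = z\<close> into the lifted channel, \<open>L\<close> drops \<open>w\<^sub>2\<close> again.\<close>

definition T_sub :: "real mat" where
  "T_sub =
     append_cols (1\<^sub>m n) (0\<^sub>m n (u + r)) @\<^sub>r
     append_cols (0\<^sub>m u n @\<^sub>r tx @\<^sub>r 0\<^sub>m r n)
       (append_cols (1\<^sub>m u) (0\<^sub>m u r) @\<^sub>r append_cols tw tc @\<^sub>r append_cols (0\<^sub>m r u) (1\<^sub>m r))"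

definition L_sub :: "real mat" where
  "L_sub =
     append_cols (1\<^sub>m n) (0\<^sub>m n (u + (v + r))) @\<^sub>r
     append_cols (0\<^sub>m (u + r) n)
       (append_cols (1\<^sub>m u) (append_cols (0\<^sub>m u v) (0\<^sub>m u r)) @\<^sub>r
        append_cols (0\<^sub>m r u) (append_cols (0\<^sub>m r v) (1\<^sub>m r)))"

lemma T_sub_left_inverse: "L_sub * T_sub = 1\<^sub>m (n + (u + r))"
  unfolding L_sub_def T_sub_def
  by (simp add: append_simps dims zero_mat_append flip: one_mat_append)

text \<open>For \<open>w_2 = z\<close> the channel rows of the lifted factor become
  \<open>(w, z, w_c)\<close> and \<open>(w, z, z_c)\<close>, which is what \<open>lift_wz\<close>
  makes of the original channel rows. State and performance rows agree because \<open>w_2\<close>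
  does not enter them.\<close>

lemma outer_F_sub_mult:
  "outer_F_sub p A' C' * T_sub =
    diag_block_mat [1\<^sub>m (n + n), lift_wz u v r, 1\<^sub>m (p + q)] * outer_F_sub p A C"
proof -
  let ?F1 = "append_cols (1\<^sub>m n) (0\<^sub>m n (u + r)) @\<^sub>r append_cols (A St St) (append_cols aw ac)"
  let ?W1 = "append_cols (0\<^sub>m u n) (append_cols (1\<^sub>m u) (0\<^sub>m u r))"
  let ?W2 = "append_cols (0\<^sub>m r n) (append_cols (0\<^sub>m r u) (1\<^sub>m r))"
  let ?Z1 = "append_cols tx (append_cols tw tc)"
  let ?Z2 = "append_cols bx (append_cols bw bc)"
  let ?F3 = "append_cols (0\<^sub>m p n) (0\<^sub>m p (u + r)) @\<^sub>r append_cols (C St) (append_cols cw cc)"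
  \<comment> \<open>The rows are grouped into state, channel and performance rows to match the
    weight \<open>diag(X, R, S)\<close>; the channel rows are split in the order \<open>w\<close>,
    \<open>w_c\<close>, \<open>z\<close>, \<open>z_c\<close> that \<open>lift_wz_mult\<close>
    expects.\<close>
  have F: "outer_F_sub p A C = ?F1 @\<^sub>r (?W1 @\<^sub>r ?W2 @\<^sub>r ?Z1 @\<^sub>r ?Z2) @\<^sub>r ?F3"
    unfolding outer_F_sub_def Let_def
    by (simp add: defs append_cols_dims append_rows_dims append_empty append_rows_assoc dims
      one_mat_append[of u r] zero_mat_append(2)[of u n r, symmetric] flip: append_swap)
  have "diag_block_mat [1\<^sub>m (n + n), lift_wz u v r, 1\<^sub>m (p + q)] * outer_F_sub p A C =
      ?F1 @\<^sub>r (lift_wz u v r * (?W1 @\<^sub>r ?W2 @\<^sub>r ?Z1 @\<^sub>r ?Z2)) @\<^sub>r ?F3"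
    unfolding F
    by (rule diag_block_mult_append_rows; intro carrier_matI; simp add: append_cols_dims append_rows_dims dims lift_wz_carrier[THEN carrier_matD(1)]  lift_wz_carrier[THEN carrier_matD(2)])
  also have "lift_wz u v r * (?W1 @\<^sub>r ?W2 @\<^sub>r ?Z1 @\<^sub>r ?Z2) =
      (?W1 @\<^sub>r ?Z1 @\<^sub>r ?W2) @\<^sub>r (?W1 @\<^sub>r ?Z1 @\<^sub>r ?Z2)"
    by (rule lift_wz_mult; intro carrier_matI; simp add: append_cols_dims append_rows_dims dims)
  \<comment> \<open>Here the substitution takes effect: in every column the lifted row of
    \<open>2 z - w_2\<close> collapses to the row of \<open>z\<close>.\<close>
  also have "?F1 @\<^sub>r ((?W1 @\<^sub>r ?Z1 @\<^sub>r ?W2) @\<^sub>r (?W1 @\<^sub>r ?Z1 @\<^sub>r ?Z2)) @\<^sub>r ?F3 = outer_F_sub p A' C' * T_sub"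
    unfolding outer_F_sub_def Let_def T_sub_def
    by (simp add: defs dims append_simps two_smult_minus)
      (simp add: append_cols_dims append_rows_dims dims append_rows_assoc flip: append_swap)
  finally show ?thesis ..
qed

text \<open>With the performance input present, \<open>z\<close> also depends on it, so the inserted
  rows carry \<open>tp\<close>; the last block row passes the performance input through.\<close>

definition T_full :: "real mat" where
  "T_full =
     append_cols (1\<^sub>m n) (append_cols (0\<^sub>m n (u + r)) (0\<^sub>m n p)) @\<^sub>r
     append_cols (0\<^sub>m u n @\<^sub>r tx @\<^sub>r 0\<^sub>m r n) (append_cols
       (append_cols (1\<^sub>m u) (0\<^sub>m u r) @\<^sub>r append_cols tw tc @\<^sub>r append_cols (0\<^sub>m r u) (1\<^sub>m r))
       (0\<^sub>m u p @\<^sub>r tp @\<^sub>r 0\<^sub>m r p)) @\<^sub>r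
     append_cols (0\<^sub>m p n) (append_cols (0\<^sub>m p (u + r)) (1\<^sub>m p))"

definition L_full :: "real mat" where
  "L_full =
     append_cols (1\<^sub>m n) (append_cols (0\<^sub>m n (u + (v + r))) (0\<^sub>m n p)) @\<^sub>r
     append_cols (0\<^sub>m (u + r) n) (append_cols
       (append_cols (1\<^sub>m u) (append_cols (0\<^sub>m u v) (0\<^sub>m u r)) @\<^sub>r
        append_cols (0\<^sub>m r u) (append_cols (0\<^sub>m r v) (1\<^sub>m r)))
       (0\<^sub>m (u + r) p)) @\<^sub>r
     append_cols (0\<^sub>m p n) (append_cols (0\<^sub>m p (u + (v + r))) (1\<^sub>m p))"

lemma T_full_left_inverse: "L_full * T_full = 1\<^sub>m (n + (u + r + p))"
proof -
  have "L_full * T_full =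
     append_cols (1\<^sub>m n) (append_cols (0\<^sub>m n (u + r)) (0\<^sub>m n p)) @\<^sub>r
     append_cols (0\<^sub>m (u + r) n) (append_cols (1\<^sub>m (u + r)) (0\<^sub>m (u + r) p)) @\<^sub>r
     append_cols (0\<^sub>m p n) (append_cols (0\<^sub>m p (u + r)) (1\<^sub>m p))"
    unfolding L_full_def T_full_def
    by (simp add: append_simps dims zero_mat_append flip: one_mat_append)
  also have "\<dots> = 1\<^sub>m (n + (u + r + p))"
    unfolding one_mat_append[of n "u + r + p"] one_mat_append[of "u + r" p]
      zero_mat_append(1)[of n "u + r" p, symmetric] zero_mat_append(2)[of "u + r" n p, symmetric]
    by (simp add: append_cols_dims append_rows_dims flip: append_swap)
  finally show ?thesis .
qed

lemma outer_F_mult: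
  "outer_F A' B' C' D * T_full =
    diag_block_mat [1\<^sub>m (n + n), lift_wz u v r, 1\<^sub>m (p + q)] * outer_F A B C D"
proof -
  let ?F1 = "append_cols (1\<^sub>m n) (append_cols (0\<^sub>m n (u + r)) (0\<^sub>m n p)) @\<^sub>r
    append_cols (A St St) (append_cols (append_cols aw ac) (B St))"
  let ?W1 = "append_cols (0\<^sub>m u n) (append_cols (append_cols (1\<^sub>m u) (0\<^sub>m u r)) (0\<^sub>m u p))"
  let ?W2 = "append_cols (0\<^sub>m r n) (append_cols (append_cols (0\<^sub>m r u) (1\<^sub>m r)) (0\<^sub>m r p))"
  let ?Z1 = "append_cols tx (append_cols (append_cols tw tc) tp)"
  let ?Z2 = "append_cols bx (append_cols (append_cols bw bc) bp)"
  let ?F3 = "append_cols (0\<^sub>m p n) (append_cols (0\<^sub>m p (u + r)) (1\<^sub>m p)) @\<^sub>r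
    append_cols (C St) (append_cols (append_cols cw cc) D)"
  have F: "outer_F A B C D = ?F1 @\<^sub>r (?W1 @\<^sub>r ?W2 @\<^sub>r ?Z1 @\<^sub>r ?Z2) @\<^sub>r ?F3"
    unfolding outer_F_def Let_def
    by (simp add: defs append_cols_dims append_rows_dims append_empty append_rows_assoc dims
      one_mat_append[of u r] zero_mat_append(2)[of u n r, symmetric] zero_mat_append(2)[of u p r, symmetric]
      flip: append_swap)
  have "diag_block_mat [1\<^sub>m (n + n), lift_wz u v r, 1\<^sub>m (p + q)] * outer_F A B C D =
      ?F1 @\<^sub>r (lift_wz u v r * (?W1 @\<^sub>r ?W2 @\<^sub>r ?Z1 @\<^sub>r ?Z2)) @\<^sub>r ?F3"
    unfolding F
    by (rule diag_block_mult_append_rows; intro carrier_matI; simp add: append_cols_dims append_rows_dims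
      dims lift_wz_carrier[THEN carrier_matD(1)] lift_wz_carrier[THEN carrier_matD(2)])
  also have "lift_wz u v r * (?W1 @\<^sub>r ?W2 @\<^sub>r ?Z1 @\<^sub>r ?Z2) =
      (?W1 @\<^sub>r ?Z1 @\<^sub>r ?W2) @\<^sub>r (?W1 @\<^sub>r ?Z1 @\<^sub>r ?Z2)"
    by (rule lift_wz_mult; intro carrier_matI; simp add: append_cols_dims append_rows_dims dims)
  also have "?F1 @\<^sub>r ((?W1 @\<^sub>r ?Z1 @\<^sub>r ?W2) @\<^sub>r (?W1 @\<^sub>r ?Z1 @\<^sub>r ?Z2)) @\<^sub>r ?F3 = outer_F A' B' C' D * T_full"
    unfolding outer_F_def Let_def T_full_def
    by (simp add: defs dims append_simps two_smult_minus)
      (simp add: append_cols_dims append_rows_dims dims append_rows_assoc flip: append_swap)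
  finally show ?thesis ..
qed

lemma carriers:
  "T_sub \<in> carrier_mat (n + (u + v + r)) (n + (u + r))"
  "L_sub \<in> carrier_mat (n + (u + r)) (n + (u + v + r))"
  "T_full \<in> carrier_mat (n + (u + v + r + p)) (n + (u + r + p))"
  "L_full \<in> carrier_mat (n + (u + r + p)) (n + (u + v + r + p))"
  "outer_F_sub p A C \<in> carrier_mat ((n + n) + ((u + r + v + r) + (p + q))) (n + (u + r))"
  "outer_F_sub p A' C' \<in> carrier_mat ((n + n) + (((u + v + r) + (u + v + r)) + (p + q))) (n + (u + v + r))"
  "outer_F A B C D \<in> carrier_mat ((n + n) + ((u + r + v + r) + (p + q))) (n + (u + r + p))"
  "outer_F A' B' C' D \<in> carrier_mat ((n + n) + (((u + v + r) + (u + v + r)) + (p + q))) (n + (u + v + r + p))"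
  unfolding T_sub_def L_sub_def T_full_def L_full_def outer_F_sub_def outer_F_def Let_def
  by (intro carrier_matI; simp add: defs append_cols_dims append_rows_dims dims)+

text \<open>The weights stay generic so that one argument serves both inequalities, which differ in
  \<open>X\<close> and \<open>S\<close>.\<close>

context
  fixes X R S :: "real mat"
  assumes XRS: "X \<in> carrier_mat (n + n) (n + n)"
    "R \<in> carrier_mat ((u + v + r) + (u + v + r)) ((u + v + r) + (u + v + r))"
    "S \<in> carrier_mat (p + q) (p + q)"
begin

text \<open>Both sides are the weight \<open>diag(X, R, S)\<close> framed by \<open>F' * T\<close>:
  on the left, \<open>lift_wz\<close> moves from the middle block into the outer factor, and
  \<open>eq\<close> identifies the result.\<close>

lemma quadratic_lift:
  assumes F: "F \<in> carrier_mat ((n + n) + ((u + r + v + r) + (p + q))) k"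
    and F': "F' \<in> carrier_mat ((n + n) + (((u + v + r) + (u + v + r)) + (p + q))) m"
    and T: "T \<in> carrier_mat m k"
    and eq: "F' * T = diag_block_mat [1\<^sub>m (n + n), lift_wz u v r, 1\<^sub>m (p + q)] * F"
  shows "F\<^sup>T * diag_block_mat [X, (lift_wz u v r)\<^sup>T * R * lift_wz u v r, S] * F =
    T\<^sup>T * (F'\<^sup>T * diag_block_mat [X, R, S] * F') * T"
proof -
  note D = diag_block_mat_carrier[OF XRS]
  have "diag_block_mat [1\<^sub>m (n + n), lift_wz u v r, 1\<^sub>m (p + q)]
      \<in> carrier_mat ((n + n) + (((u + v + r) + (u + v + r)) + (p + q))) ((n + n) + ((u + r + v + r) + (p + q)))"
    by (intro diag_block_mat_carrier one_carrier_mat lift_wz_carrier)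
  from transpose_sandwich[OF D this F] transpose_sandwich[OF D F' T]
  show ?thesis
    unfolding eq diag_block_congruence[OF XRS lift_wz_carrier] by simp
qed

text \<open>By \<open>quadratic_lift\<close> the original expression is the lifted one framed by
  \<open>T_sub\<close>; the left inverse \<open>L_sub\<close> keeps the inequality strict.\<close>

lemma neg_def_lmi_sub_lift:
  assumes "neg_def (lmi_sub p X R S A' C')"
  shows "neg_def (lmi_sub p X ((lift_wz u v r)\<^sup>T * R * lift_wz u v r) S A C)"
  unfolding lmi_sub_def quadratic_lift[OF carriers(5,6,1) outer_F_sub_mult]
  using assms unfolding lmi_sub_def
  by (rule def_congruence(2)[OF _ carriers(1,2) T_sub_left_inverse, rotated])
    (use diag_block_mat_carrier[OF XRS] carriers(6) in auto)

lemma neg_def_lmi_lift: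
  assumes "neg_def (lmi X R S A' B' C' D)"
  shows "neg_def (lmi X ((lift_wz u v r)\<^sup>T * R * lift_wz u v r) S A B C D)"
  unfolding lmi_def quadratic_lift[OF carriers(7,8,3) outer_F_mult]
  using assms unfolding lmi_def
  by (rule def_congruence(2)[OF _ carriers(3,4) T_full_left_inverse, rotated])
    (use diag_block_mat_carrier[OF XRS] carriers(8) in auto)

end

end

section \<open>Positivity on the graph of the uncertainty\<close>

lemma off_diag_sym_mats: "P \<in> sym_mats n \<Longrightarrow> off_diag P \<in> sym_mats (n + n)"
  by (auto simp: sym_mats_def off_diag_def block_mat_def block_row_def append_empty append_cols_dims
    append_rows_dims Let_def transpose_append append_swap)

text \<open>On the graph of \<open>W\<close> the off-diagonal scaling pairs \<open>W y\<close> with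
  \<open>y\<close> twice, giving \<open>P * W\<close> plus its transpose.\<close>

lemma off_diag_form:
  assumes P: "P \<in> sym_mats m" and W: "W \<in> carrier_mat m m" and Y: "Y \<in> carrier_mat m n"
  shows "(W * Y @\<^sub>r Y)\<^sup>T * off_diag P * (W * Y @\<^sub>r Y) = Y\<^sup>T * He (P * W) * Y"
proof -
  have P: "P \<in> carrier_mat m m" "P\<^sup>T = P" using P by (auto simp: sym_mats_def)
  note d = P(1)[THEN carrier_matD(1)] P(1)[THEN carrier_matD(2)] W[THEN carrier_matD(1)] W[THEN carrier_matD(2)]
    Y[THEN carrier_matD(1)] Y[THEN carrier_matD(2)]
  have "(W * Y @\<^sub>r Y)\<^sup>T * off_diag P * (W * Y @\<^sub>r Y) = Y\<^sup>T * P * (W * Y) + (W * Y)\<^sup>T * P * Y"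
    using d by (simp add: off_diag_def block_mat_def block_row_def Let_def transpose_append append_simps)
  also have "Y\<^sup>T * P * (W * Y) = Y\<^sup>T * (P * W) * Y"
    using P W Y assoc_mult_mat[of "Y\<^sup>T" n m P m W m] assoc_mult_mat[of "Y\<^sup>T * P" n m W m Y n] by auto
  \<comment> \<open>The symmetry of \<open>P\<close> turns \<open>W\<^sup>T * P\<close> into the
    transpose of \<open>P * W\<close>.\<close>
  also have "(W * Y)\<^sup>T * P * Y = Y\<^sup>T * (P * W)\<^sup>T * Y"
    using P W Y transpose_mult[OF W Y] transpose_mult[OF P(1) W] assoc_mult_mat[of "Y\<^sup>T" n m "W\<^sup>T" m P m] by auto
  also have "Y\<^sup>T * (P * W) * Y + Y\<^sup>T * (P * W)\<^sup>T * Y = Y\<^sup>T * He (P * W) * Y"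
    unfolding He_def using P W Y
    by (subst mult_add_distrib_mat[of _ n m _ m], simp_all)
      (subst add_mult_distrib_mat[of _ n m _ _ n], simp_all)
  finally show ?thesis .
qed

text \<open>\<open>Y\<close> sends \<open>(z, z_c)\<close> to the lifted output
  \<open>(V z, z, z_c)\<close>. Since \<open>- V z + 2 V z = V z\<close>, the lifted uncertainty
  maps this to \<open>(V z, z, S z_c)\<close>. Thus \<open>lift_wz\<close> carries the graph of the
  original uncertainty into the graph of the lifted one.\<close>

lemma lift_unc_fixed:
  assumes "V \<in> carrier_mat u v" "S \<in> carrier_mat r r"
  defines "Y \<equiv> append_cols V (0\<^sub>m u r) @\<^sub>r append_cols (1\<^sub>m v) (0\<^sub>m v r) @\<^sub>r append_cols (0\<^sub>m r v) (1\<^sub>m r)"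
  shows "diag_block_mat [lift_unc V, S] \<in> carrier_mat (u + v + r) (u + v + r)"
    and "lift_wz u v r * block_mat [[diag_block_mat [V, S]], [1\<^sub>m (v + r)]] =
      diag_block_mat [lift_unc V, S] * Y @\<^sub>r Y"
proof -
  note d = assms(1,2)[THEN carrier_matD(1)] assms(1,2)[THEN carrier_matD(2)]
  \<comment> \<open>Regrouped to match the column split of the block diagonal into
    \<open>u + v\<close> and \<open>r\<close>.\<close>
  have Y: "Y = (append_cols V (0\<^sub>m u r) @\<^sub>r append_cols (1\<^sub>m v) (0\<^sub>m v r)) @\<^sub>r append_cols (0\<^sub>m r v) (1\<^sub>m r)"
    unfolding Y_def using d by (simp add: append_rows_assoc append_cols_dims)
  have W: "diag_block_mat [lift_unc V, S] =
    append_cols (append_cols (- 1\<^sub>m u) (2 \<cdot>\<^sub>m V) @\<^sub>r append_cols (0\<^sub>m v u) (1\<^sub>m v)) (0\<^sub>m (u + v) r) @\<^sub>r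
    append_cols (0\<^sub>m r (u + v)) S"
    unfolding diag_block_mat_append lift_unc_def using d
    by (simp add: block_mat_def block_row_def append_empty append_cols_dims append_rows_dims)
  show "diag_block_mat [lift_unc V, S] \<in> carrier_mat (u + v + r) (u + v + r)"
    unfolding W by (rule carrier_matI) (simp_all add: append_cols_dims append_rows_dims d)
  have "diag_block_mat [lift_unc V, S] * Y =
      append_cols V (0\<^sub>m u r) @\<^sub>r append_cols (1\<^sub>m v) (0\<^sub>m v r) @\<^sub>r append_cols (0\<^sub>m r v) S"
    unfolding W Y using d
    by (simp add: append_simps two_smult_minus zero_mat_append) (simp add: append_cols_dims append_rows_assoc)
  moreover have "block_mat [[diag_block_mat [V, S]], [1\<^sub>m (v + r)]] =
      append_cols V (0\<^sub>m u r) @\<^sub>r append_cols (0\<^sub>m r v) S @\<^sub>r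
      append_cols (1\<^sub>m v) (0\<^sub>m v r) @\<^sub>r append_cols (0\<^sub>m r v) (1\<^sub>m r)"
    unfolding block_mat_def block_row_def diag_block_mat_append one_mat_append using d
    by (simp add: append_empty append_cols_dims append_rows_dims append_rows_assoc)
  moreover have "lift_wz u v r * (append_cols V (0\<^sub>m u r) @\<^sub>r append_cols (0\<^sub>m r v) S @\<^sub>r
      append_cols (1\<^sub>m v) (0\<^sub>m v r) @\<^sub>r append_cols (0\<^sub>m r v) (1\<^sub>m r)) =
      (append_cols V (0\<^sub>m u r) @\<^sub>r append_cols (1\<^sub>m v) (0\<^sub>m v r) @\<^sub>r append_cols (0\<^sub>m r v) S) @\<^sub>r Y"
    unfolding Y_def by (rule lift_wz_mult; intro carrier_matI; simp add: append_cols_dims d)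
  ultimately show "lift_wz u v r * block_mat [[diag_block_mat [V, S]], [1\<^sub>m (v + r)]] =
      diag_block_mat [lift_unc V, S] * Y @\<^sub>r Y"
    by simp
qed

text \<open>On the graph described by \<open>lift_unc_fixed\<close>, the form of the new scaling
  reduces to the given positive definite matrix framed by \<open>Y\<close>.\<close>

lemma pos_def_uncertainty_lift:
  assumes P: "P \<in> sym_mats (u + v + r)" and V: "V \<in> carrier_mat u v" and S: "S \<in> carrier_mat r r"
    and pos: "pos_def (He (P * diag_block_mat [lift_unc V, S]))"
  defines "J \<equiv> block_mat [[diag_block_mat [V, S]], [1\<^sub>m (v + r)]]"
  shows "pos_def (J\<^sup>T * ((lift_wz u v r)\<^sup>T * off_diag P * lift_wz u v r) * J)"
proof -
  define Y where "Y = append_cols V (0\<^sub>m u r) @\<^sub>r append_cols (1\<^sub>m v) (0\<^sub>m v r) @\<^sub>r append_cols (0\<^sub>m r v) (1\<^sub>m r)"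
  \<comment> \<open>Dropping the component \<open>V z\<close> recovers \<open>(z, z_c)\<close>, so
    \<open>Y\<close> is injective.\<close>
  define L :: "real mat" where "L = append_cols (0\<^sub>m v u) (append_cols (1\<^sub>m v) (0\<^sub>m v r)) @\<^sub>r
    append_cols (0\<^sub>m r u) (append_cols (0\<^sub>m r v) (1\<^sub>m r))"
  note d = V[THEN carrier_matD(1)] V[THEN carrier_matD(2)] S[THEN carrier_matD(1)] S[THEN carrier_matD(2)]
  note W = lift_unc_fixed[OF V S]
  have Y: "Y \<in> carrier_mat (u + v + r) (v + r)" and L: "L \<in> carrier_mat (v + r) (u + v + r)"
    unfolding Y_def L_def by (auto intro!: carrier_matI simp: append_cols_dims append_rows_dims d)
  have J: "J \<in> carrier_mat (u + r + v + r) (v + r)"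
    unfolding J_def block_mat_def block_row_def diag_block_mat_append
    by (rule carrier_matI) (simp_all add: append_cols_dims append_rows_dims append_empty d)
  have LY: "L * Y = 1\<^sub>m (v + r)"
    unfolding L_def Y_def using d by (simp add: append_simps flip: one_mat_append)
  have "off_diag P \<in> carrier_mat ((u + v + r) + (u + v + r)) ((u + v + r) + (u + v + r))"
    using off_diag_sym_mats[OF P] by (simp add: sym_mats_def)
  note transpose_sandwich[OF this lift_wz_carrier J]
  also have "lift_wz u v r * J = diag_block_mat [lift_unc V, S] * Y @\<^sub>r Y"
    unfolding J_def Y_def by (rule W(2))
  finally have "J\<^sup>T * ((lift_wz u v r)\<^sup>T * off_diag P * lift_wz u v r) * J =
      Y\<^sup>T * He (P * diag_block_mat [lift_unc V, S]) * Y"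
    unfolding off_diag_form[OF P W(1) Y] .
  moreover have "He (P * diag_block_mat [lift_unc V, S]) \<in> carrier_mat (u + v + r) (u + v + r)"
    using P W(1) by (auto simp: He_def sym_mats_def)
  ultimately show ?thesis
    using def_congruence(1)[OF _ Y L LY pos] by simp
qed

section \<open>Closed loops of the two plants\<close>

lemma structured_controllerD:
  assumes "structured_controller m k \<V> K"
  shows "coD K = 0\<^sub>m m k" "V \<in> \<V> \<Longrightarrow> sched K V \<in> carrier_mat (r_co K) (r_co K)"
proof -
  show "coD K = 0\<^sub>m m k"
    using assms by (simp add: structured_controller_def Let_def)
  assume "V \<in> \<V>"
  then obtain D11 D21 D22 where "D11 \<in> carrier_mat (r_co1 K) (r_co1 K)" "D21 \<in> carrier_mat (r_co2 K) (r_co1 K)"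
    "D22 \<in> carrier_mat (r_co2 K) (r_co2 K)"
    and "sched K V = block_mat [[D11, 0\<^sub>m (r_co1 K) (r_co2 K)], [D21, D22]]"
    using assms unfolding structured_controller_def Let_def by blast
  then show "sched K V \<in> carrier_mat (r_co K) (r_co K)"
    by (intro carrier_matI)
      (simp_all add: r_co_def block_mat_def block_row_def append_empty append_cols_dims append_rows_dims)
qed

lemma lifted_plant_simps [simp]:
  "n_st (lifted_plant G) = n_st G" "n_w (lifted_plant G) = n_w G + n_z G" "n_z (lifted_plant G) = n_w G + n_z G"
  "n_wp (lifted_plant G) = n_wp G" "n_zp (lifted_plant G) = n_zp G"
  "n_u (lifted_plant G) = n_u G" "n_y (lifted_plant G) = n_y G"
  "plDp (lifted_plant G) = plDp G" "plD1 (lifted_plant G) = plD1 G" "plD2 (lifted_plant G) = plD2 G"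
  "plA (lifted_plant G) St St = plA G St St"
  "plA (lifted_plant G) St Ch = append_cols (plA G St Ch) (0\<^sub>m (n_st G) (n_z G))"
  "plA (lifted_plant G) Ch St = 0\<^sub>m (n_w G) (n_st G) @\<^sub>r 2 \<cdot>\<^sub>m plA G Ch St"
  "plA (lifted_plant G) Ch Ch = append_cols (1\<^sub>m (n_w G)) (0\<^sub>m (n_w G) (n_z G)) @\<^sub>r
    append_cols (2 \<cdot>\<^sub>m plA G Ch Ch) (- 1\<^sub>m (n_z G))"
  "plBp (lifted_plant G) St = plBp G St"
  "plBp (lifted_plant G) Ch = 0\<^sub>m (n_w G) (n_wp G) @\<^sub>r 2 \<cdot>\<^sub>m plBp G Ch"
  "plB (lifted_plant G) St = plB G St"
  "plB (lifted_plant G) Ch = 0\<^sub>m (n_w G) (n_u G) @\<^sub>r 2 \<cdot>\<^sub>m plB G Ch"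
  "plCp (lifted_plant G) St = plCp G St"
  "plCp (lifted_plant G) Ch = append_cols (plCp G Ch) (0\<^sub>m (n_zp G) (n_z G))"
  "plC (lifted_plant G) St = plC G St"
  "plC (lifted_plant G) Ch = append_cols (plC G Ch) (0\<^sub>m (n_y G) (n_z G))"
  by (simp_all add: lifted_plant_def Let_def block_mat_def block_row_def append_empty)

lemma plant_sizes_lifted:
  assumes "plant_sizes G"
  shows "plant_sizes (lifted_plant G)"
proof -
  have all_ix: "(\<forall>i. Q i) \<longleftrightarrow> Q St \<and> Q Ch" for Q by (metis ix.exhaust)
  show ?thesis
    using assms unfolding plant_sizes_def all_ix
    by (simp add: pl_out_def pl_in_def append_carrier)
qed

text \<open>Since the controller has no direct feedthrough, every term containing
  \<open>coD K\<close> vanishes and the plant blocks appear unchanged next to the products with the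
  controller.\<close>

lemma closed_loop_eq:
  assumes G: "plant_sizes G" and K: "structured_controller (n_u G) (n_y G) \<V> K"
  shows "clA G K i j = append_cols (plA G i j) (plB G i * coC K j) @\<^sub>r append_cols (coB K i * plC G j) (coA K i j)"
    "clB G K i = plBp G i @\<^sub>r coB K i * plD2 G"
    "clC G K j = append_cols (plCp G j) (plD1 G * coC K j)"
    "clD G K = plDp G"
proof -
  note d = cl_sizes[OF G K, THEN carrier_matD(1)] cl_sizes[OF G K, THEN carrier_matD(2)]
  have zero: "M * 0\<^sub>m (n_u G) (n_y G) * N = 0\<^sub>m (dim_row M) (dim_col N)"
    if "dim_col M = n_u G" "dim_row N = n_y G" for M N :: "real mat"
    using that by (simp add: zero_one_mat_simps)
  show "clA G K i j = append_cols (plA G i j) (plB G i * coC K j) @\<^sub>r append_cols (coB K i * plC G j) (coA K i j)"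
    "clB G K i = plBp G i @\<^sub>r coB K i * plD2 G"
    "clC G K j = append_cols (plCp G j) (plD1 G * coC K j)"
    "clD G K = plDp G"
    unfolding clA_def clB_def clC_def clD_def cl_split_eq[OF G K] structured_controllerD(1)[OF K]
      block_mat_def block_row_def
    by (simp_all add: zero zero_one_mat_simps append_empty d)
qed

text \<open>The zero columns of the lifted plant at \<open>w_2\<close> survive multiplication by
  controller blocks, and the factor 2 in its \<open>z_2\<close> rows can be pulled out of the
  products. This gives the pattern of the locale, whose \<open>n\<close> counts plant and controller
  states together.\<close>

lemma lifted_loop_closed_loop:
  assumes G: "plant_sizes G" and K: "structured_controller (n_u G) (n_y G) \<V> K"
  shows "lifted_loop (n_st G + n_co K) (n_w G) (n_z G) (r_co K) (n_wp G) (n_zp G)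
    (plA G St Ch @\<^sub>r coB K St * plC G Ch) (plB G St * coC K Ch @\<^sub>r coA K St Ch)
    (append_cols (plA G Ch St) (plB G Ch * coC K St)) (plA G Ch Ch) (plB G Ch * coC K Ch) (plBp G Ch)
    (append_cols (coB K Ch * plC G St) (coA K Ch St)) (coB K Ch * plC G Ch) (coA K Ch Ch) (coB K Ch * plD2 G)
    (plCp G Ch) (plD1 G * coC K Ch) (plDp G)
    (clA G K) (clA (lifted_plant G) K) (clB G K) (clB (lifted_plant G) K) (clC G K) (clC (lifted_plant G) K)"
proof -
  note closed = closed_loop_eq[OF G K]
    closed_loop_eq[OF plant_sizes_lifted[OF G], unfolded lifted_plant_simps, OF K]
  note sizes = cl_sizes[OF G K]
  note d = sizes[THEN carrier_matD(1)] sizes[THEN carrier_matD(2)]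
  note dims = append_cols_dims append_rows_dims d pl_in_def pl_out_def co_dim_def
  have smult: "2 \<cdot>\<^sub>m append_cols M N = append_cols (2 \<cdot>\<^sub>m M) (2 \<cdot>\<^sub>m N)"
    if "dim_row M = dim_row N" for M N :: "real mat"
    using that by (intro eq_matI) (auto simp: append_cols_dims append_cols_index)
  have mult: "2 \<cdot>\<^sub>m M * N = 2 \<cdot>\<^sub>m (M * N)" if "dim_col M = dim_row N" for M N :: "real mat"
    using that by (intro eq_matI) auto
  show ?thesis
    \<comment> \<open>The two instances of \<open>zero_mat_append\<close> split zero blocks along
      the joint state into plant and controller parts.\<close>
    by (unfold_locales; (intro carrier_matI; simp add: closed dims)?)
      (simp_all add: closed dims mult_append_cols append_rows_mult append_cols_assoc append_rows_assoc smult mult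
        zero_mat_append(1)[of "n_w G" "n_st G" "n_co K", symmetric]
        zero_mat_append(2)[of "n_st G" "n_z G" "n_co K", symmetric] flip: append_swap)
qed

section \<open>The scaling of the original loop\<close>

theorem theorem4:
  fixes G :: plant and K :: controller
    and nu nv N :: nat and \<Delta> :: "nat \<Rightarrow> real mat" and \<V> :: "real mat set"
    and \<gamma> :: real and X Z P :: "real mat"
  assumes "structured_plant nu nv G"
    and "value_set nu nv N \<Delta> \<V>"
    and "\<gamma> > 0"
    and "structured_controller (n_u G) (n_y G) \<V> K"
    and "X \<in> sym_mats (n_st G + n_co K)" and "pos_def X"
    and "Z \<in> sym_mats (n_zp G)" and "pos_def Z" and "mat_trace Z < 1"
    and "P \<in> scalings G \<V> K"
    and "neg_def (lmi_sub (n_wp G) (neg_first X) (off_diag P) (P_Z (n_wp G) Z)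
           (clA (lifted_plant G) K) (clC (lifted_plant G) K))"
    and "neg_def (lmi (off_diag X) (off_diag P) (P_gamma (n_wp G) (n_zp G) \<gamma>)
           (clA (lifted_plant G) K) (clB (lifted_plant G) K)
           (clC (lifted_plant G) K) (clD (lifted_plant G) K))"
  shows "\<exists>Q \<in> sym_mats (n_w G + r_co K + n_z G + r_co K).
      (\<forall>V \<in> \<V>. pos_def
         ((block_mat [[unc_ex K V], [1\<^sub>m (n_z G + r_co K)]])\<^sup>T * Q *
           block_mat [[unc_ex K V], [1\<^sub>m (n_z G + r_co K)]])) \<and>
      neg_def (lmi_sub (n_wp G) (neg_first X) Q (P_Z (n_wp G) Z) (clA G K) (clC G K)) \<and>
      neg_def (lmi (off_diag X) Q (P_gamma (n_wp G) (n_zp G) \<gamma>)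
         (clA G K) (clB G K) (clC G K) (clD G K))"
proof -
  let ?u = "n_w G" and ?v = "n_z G" and ?r = "r_co K"
  let ?E = "lift_wz ?u ?v ?r"
  \<comment> \<open>The witness is the form \<open>2 (w, z, z_c)\<^sup>T P (w, z, w_c)\<close>; it
    involves neither \<open>V\<close> nor the performance weights, so one matrix serves all three
    conclusions.\<close>
  let ?Q = "?E\<^sup>T * off_diag P * ?E"
  have G: "plant_sizes G" and uv: "?u = nu + nu" "?v = nv + nv"
    using assms(1) by (auto simp: structured_plant_def)
  note K = assms(4)
  interpret lifted_loop "n_st G + n_co K" ?u ?v ?r "n_wp G" "n_zp G"
    "plA G St Ch @\<^sub>r coB K St * plC G Ch" "plB G St * coC K Ch @\<^sub>r coA K St Ch"
    "append_cols (plA G Ch St) (plB G Ch * coC K St)" "plA G Ch Ch" "plB G Ch * coC K Ch" "plBp G Ch"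
    "append_cols (coB K Ch * plC G St) (coA K Ch St)" "coB K Ch * plC G Ch" "coA K Ch Ch" "coB K Ch * plD2 G"
    "plCp G Ch" "plD1 G * coC K Ch" "plDp G"
    "clA G K" "clA (lifted_plant G) K" "clB G K" "clB (lifted_plant G) K" "clC G K" "clC (lifted_plant G) K"
    by (rule lifted_loop_closed_loop[OF G K])
  \<comment> \<open>The locale has a single feedthrough \<open>D\<close> for both loops, so the two
    closed-loop feedthroughs have to be identified.\<close>
  have D: "clD G K = plDp G" "clD (lifted_plant G) K = plDp G"
    using closed_loop_eq(4)[OF G K] closed_loop_eq(4)[of "lifted_plant G", OF plant_sizes_lifted[OF G]] K by auto
  have P: "P \<in> sym_mats (?u + ?v + ?r)" and pos: "\<And>V. V \<in> \<V> \<Longrightarrow> pos_def (He (P * unc_lc K V))"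
    using assms(10) by (auto simp: scalings_def)
  note R = off_diag_sym_mats[OF P]
  have Rc: "off_diag P \<in> carrier_mat ((?u + ?v + ?r) + (?u + ?v + ?r)) ((?u + ?v + ?r) + (?u + ?v + ?r))"
    using R by (simp add: sym_mats_def)
  have X: "off_diag X \<in> carrier_mat ((n_st G + n_co K) + (n_st G + n_co K)) ((n_st G + n_co K) + (n_st G + n_co K))"
    "neg_first X \<in> carrier_mat ((n_st G + n_co K) + (n_st G + n_co K)) ((n_st G + n_co K) + (n_st G + n_co K))"
    using assms(5)
    by (auto intro!: carrier_matI simp: sym_mats_def off_diag_def neg_first_def block_mat_def block_row_def Let_def
      append_empty append_cols_dims append_rows_dims)
  have Z: "P_Z (n_wp G) Z \<in> carrier_mat (n_wp G + n_zp G) (n_wp G + n_zp G)"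
    using assms(7) pos_def_mat_inverse_carrier[OF assms(8), of "n_zp G"]
    by (auto intro!: carrier_matI simp: sym_mats_def P_Z_def block_mat_def block_row_def Let_def
      append_empty append_cols_dims append_rows_dims)
  have gamma: "P_gamma (n_wp G) (n_zp G) \<gamma> \<in> carrier_mat (n_wp G + n_zp G) (n_wp G + n_zp G)"
    by (intro carrier_matI) (simp_all add: P_gamma_def block_mat_def block_row_def
      append_empty append_cols_dims append_rows_dims)
  have V: "V \<in> carrier_mat ?u ?v" if "V \<in> \<V>" for V
    using assms(2) that uv by (auto simp: value_set_def mat_hull_def)
  show ?thesis
  proof (intro bexI[of _ ?Q] conjI ballI)
    show "?Q \<in> sym_mats (?u + ?r + ?v + ?r)"
      by (rule sym_mats_congruence[OF R lift_wz_carrier])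
    show "pos_def ((block_mat [[unc_ex K V], [1\<^sub>m (?v + ?r)]])\<^sup>T * ?Q * block_mat [[unc_ex K V], [1\<^sub>m (?v + ?r)]])"
      if "V \<in> \<V>" for V
      using pos_def_uncertainty_lift[OF P V[OF that] structured_controllerD(2)[OF K that]] pos[OF that]
      by (simp add: unc_ex_def unc_lc_def)
    show "neg_def (lmi_sub (n_wp G) (neg_first X) ?Q (P_Z (n_wp G) Z) (clA G K) (clC G K))"
      by (rule neg_def_lmi_sub_lift[OF X(2) Rc Z assms(11)])
    show "neg_def (lmi (off_diag X) ?Q (P_gamma (n_wp G) (n_zp G) \<gamma>) (clA G K) (clB G K) (clC G K) (clD G K))"
      using neg_def_lmi_lift[OF X(1) Rc gamma] assms(12) unfolding D by blast
  qed
qed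

end
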